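(* For $u\in U$ put $f_u(x)=F(u,x)$, $x\in\mathbb{R}^m$. Assume: (c2) the class $\{f_u:u\in U\}$ has a $P_X$-integrable envelope function $g$; (c3) $F(\cdot,x)$ is a continuous function for all $x\in\mathbb{R}^m$; (c4) the set $U$ is compact. (i1) Let $\{\mu_N\}_{N=1}^\infty$ be a proper approximate convolution identity, and suppose the functions $f_u$, $u\in U$, admit a $\mu_N$-adapted non-decreasing modulus of continuity independent of $u$. Then the estimator $\theta_\mu^{(N)}$ of $\theta$ is strongly consistent, i.e. $\theta_\mu^{(N)}\to\theta$ almost surely as $N\to\infty$. Furthermore, $\mathsf{D}(S_\mu^{(N)},S)\to0$ almost surely as $N\to\infty$. (i2) Let $K$ be a kernel function on $\mathbb{R}^m$ satisfying (k1) and (k2), let $h_N>0$ with $\lim_{N\to\infty}h_N=0$, and suppose the functions $f_u$, $u\in U$, admit a $K$-integrable non-decreasing modulus of continuity independent of $u$. Then $\theta_K^{(N)}$ is a strongly consistent estimator of $\theta$, i.e. $\theta_K^{(N)}\to\theta$ almost surely as $N\to\infty$. Additionally, $\mathsf{D}(S_K^{(N)},S)\to0$ almost surely as $N\to\infty$.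
   Context: $U\subset\mathbb{R}^n$ is nonempty and closed. $X$ is an integrable random vector with values in $\mathbb{R}^m$ on a probability space, with law $P_X$. $F:\mathbb{R}^n\times\mathbb{R}^m\to\mathbb{R}$ is sufficiently regular that $\mathbb{E}[F(u,X)]$ is well defined and finite for all $u\in U$. $X_1,X_2,\dots$ is a sample of $X$ (independent random vectors distributed as $X$), and $P_N=\frac1N\sum_{i=1}^N\delta(X_i)$ is the empirical measure. Problems: $\theta=\min_{u\in U}\mathbb{E}[F(u,X)]$ with set of optimal solutions $S$; $$\theta_\mu^{(N)}=\min_{u\in U}\frac1N\sum_{i=1}^N\int_{\mathbb{R}^m}F(u,X_i+z)\,d\mu_N(z)$$ with set of optimal solutions $S_\mu^{(N)}$; $$\theta_K^{(N)}=\min_{u\in U}\frac1N\sum_{i=1}^N\int_{\mathbb{R}^m}F(u,x)K\Big(\frac{x-X_i}{h_N}\Big)\frac1{h_N^m}\,dx$$ with set of optimal solutions $S_K^{(N)}$. For $A,B\subset\mathbb{R}^n$, $\mathsf{D}(A,B)=\sup_{x\in A}\inf_{y\in B}\|x-y\|$ is the deviation of $A$ from $B$. Proper approximate convolution identity: a sequence $\{\mu_N\}_{N=1}^\infty$ of measures on $\mathbb{R}^m$, with $\mu_N$ independent of the respective $P_N$, normalized by $\mu_N(\mathbb{R}^m)=1$, such that $\mu_N$ converges weakly to the point mass $\delta(0)$ as $N\to\infty$ and, for every $a>0$, $\lim_{N\to\infty}|\mu_N|(\mathbb{R}^m\setminus[-a,a]^m)=0$, where $|\mu_N|$ denotes the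 total variation of $\mu_N$. The functions $f_u$ admit a $\mu_N$-adapted non-decreasing modulus of continuity independent of $u$ if there is a non-decreasing $w:\mathbb{R}_+\to\mathbb{R}$ with $\lim_{t\downarrow0}w(t)=0$, $|f_u(x+z)-f_u(x)|\le w(\|z\|)$ for all $x,z\in\mathbb{R}^m$, $u\in U$, and $\lim_{N\to\infty}\int_{\mathbb{R}^m}w(\|z\|)\,d\mu_N(z)=0$. They admit a $K$-integrable non-decreasing modulus of continuity independent of $u$ if there is such a $w$ with the last condition replaced by $\int_{\mathbb{R}^m}w(\|z\|)K(z)\,dz<\infty$. (k1): $K$ is a symmetric around zero density function with respect to the Lebesgue measure on $\mathbb{R}^m$, i.e. $\int_{\mathbb{R}}y_lK(y)\,dy_l=0$ for $l=1,\dots,m$ (integration in the $l$-th coordinate of $y=(y_1,\dots,y_m)$). (k2): the second-order moment $m_2(K)=\int_{\mathbb{R}^m}\|y\|^2K(y)\,dy$ is a finite positive number. A function $g:\mathbb{R}^m\to\mathbb{R}$ is an envelope function of $\{f_u:u\in U\}$ if $|f_u(x)|\le g(x)<\infty$ for all $x\in\mathbb{R}^m$ and all $u\in U$.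
   Formalization: In the adapted modulus condition the integral of w(‖z‖) is taken with respect to |μ_N|; for nonnegative μ_N this is the stated condition, while for signed μ_N the stated one fails: F(u,x)=x, w(t)=t, μ_N=δ(0)+(δ(N)−δ(−N))/N shifts θ_μ^{(N)} by 2. *)

theory Defs
  imports "HOL-Probability.Probability"
begin

section \<open>Optimization problems and deviation of sets\<close>

text \<open>The minimal value is the least element of the image, so it is meaningful only if the
  minimum is attained.\<close>

definition opt_value :: "'a set \<Rightarrow> ('a \<Rightarrow> real) \<Rightarrow> real" where
  "opt_value U \<phi> = (LEAST t. t \<in> \<phi> ` U)"

definition opt_set :: "'a set \<Rightarrow> ('a \<Rightarrow> real) \<Rightarrow> 'a set" where
  "opt_set U \<phi> = {u \<in> U. \<forall>v\<in>U. \<phi> u \<le> \<phi> v}"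

text \<open>Values in the extended nonnegative reals: the infimum over the empty set is infinite, the
  supremum over the empty set is zero.\<close>

definition deviation :: "'a::real_normed_vector set \<Rightarrow> 'a set \<Rightarrow> ennreal" where
  "deviation A B = (SUP x\<in>A. INF y\<in>B. ennreal (norm (x - y)))"


section \<open>Finite signed Borel measures\<close>

text \<open>A finite signed Borel measure is represented by its Jordan decomposition, that is, by its
  (positive part, negative part), two mutually singular finite Borel measures. An ordinary finite
  measure is the case where the second component is the null measure.\<close>

type_synonym 'a smeasure = "'a measure \<times> 'a measure"

definition signed_measure :: "'a::topological_space smeasure \<Rightarrow> bool" where
  "signed_measure \<nu> \<longleftrightarrow>
     finite_measure (fst \<nu>) \<and> sets (fst \<nu>) = sets borel \<and>
     finite_measure (snd \<nu>) \<and> sets (snd \<nu>) = sets borel \<and>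
     (\<exists>A\<in>sets borel. emeasure (fst \<nu>) (- A) = 0 \<and> emeasure (snd \<nu>) A = 0)"

definition smeas :: "'a smeasure \<Rightarrow> 'a set \<Rightarrow> real" where
  "smeas \<nu> A = measure (fst \<nu>) A - measure (snd \<nu>) A"

definition sintegral :: "'a smeasure \<Rightarrow> ('a \<Rightarrow> real) \<Rightarrow> real" where
  "sintegral \<nu> f = (LINT z|fst \<nu>. f z) - (LINT z|snd \<nu>. f z)"

definition total_variation :: "'a smeasure \<Rightarrow> 'a set \<Rightarrow> real" where
  "total_variation \<nu> A = measure (fst \<nu>) A + measure (snd \<nu>) A"

definition tv_nn_integral :: "'a smeasure \<Rightarrow> ('a \<Rightarrow> ennreal) \<Rightarrow> ennreal" where
  "tv_nn_integral \<nu> f = (\<integral>\<^sup>+ z. f z \<partial>fst \<nu>) + (\<integral>\<^sup>+ z. f z \<partial>snd \<nu>)"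

definition weakly_to_delta0 :: "(nat \<Rightarrow> 'a::real_normed_vector smeasure) \<Rightarrow> bool" where
  "weakly_to_delta0 \<nu> \<longleftrightarrow>
     (\<forall>\<phi>. continuous_on UNIV \<phi> \<and> bounded (range \<phi>) \<longrightarrow>
        (\<lambda>N. sintegral (\<nu> N) \<phi>) \<longlonglongrightarrow> \<phi> 0)"


section \<open>Approximate convolution identities\<close>

text \<open>Samples are indexed from 1 on.\<close>

definition empirical :: "(nat \<Rightarrow> 'w \<Rightarrow> 'a) \<Rightarrow> nat \<Rightarrow> 'w \<Rightarrow> 'a set \<Rightarrow> real" where
  "empirical X N \<omega> A = (\<Sum>i=1..N. indicator A (X i \<omega>)) / real N"

text \<open>The sigma-algebra generated by a random set function, that is, by all its evaluations at
  Borel sets.\<close>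

definition generated_events ::
  "'w measure \<Rightarrow> ('w \<Rightarrow> 'a::topological_space set \<Rightarrow> real) \<Rightarrow> 'w set set" where
  "generated_events M \<nu> =
     sigma_sets (space M)
       {(\<lambda>\<omega>. \<nu> \<omega> A) -` B \<inter> space M | A B. A \<in> sets borel \<and> B \<in> sets borel}"

text \<open>The smoothing measures may be random; a deterministic sequence is the special case where
  they do not depend on the outcome, for which the independence condition holds trivially and the
  almost sure qualifications disappear. Measurability of a random measure is part of
  \<open>indep_set\<close>.\<close>

definition proper_approx_conv_identity ::
  "'w measure \<Rightarrow> (nat \<Rightarrow> 'w \<Rightarrow> real ^ 'm) \<Rightarrow> (nat \<Rightarrow> 'w \<Rightarrow> (real ^ 'm) smeasure) \<Rightarrow> bool" where
  "proper_approx_conv_identity M X \<mu> \<longleftrightarrow>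
     (\<forall>N\<ge>1. (\<forall>\<omega>\<in>space M. signed_measure (\<mu> N \<omega>) \<and> smeas (\<mu> N \<omega>) UNIV = 1) \<and>
        prob_space.indep_set M (generated_events M (\<lambda>\<omega>. smeas (\<mu> N \<omega>)))
                               (generated_events M (empirical X N))) \<and>
     (AE \<omega> in M. weakly_to_delta0 (\<lambda>N. \<mu> N \<omega>) \<and>
        (\<forall>a>0. (\<lambda>N. total_variation (\<mu> N \<omega>) (- cbox (\<chi> l. - a) (\<chi> l. a))) \<longlonglongrightarrow> 0))"


section \<open>Moduli of continuity and kernels\<close>

definition uniform_modulus ::
  "'u set \<Rightarrow> ('u \<Rightarrow> 'a::real_normed_vector \<Rightarrow> real) \<Rightarrow> (real \<Rightarrow> real) \<Rightarrow> bool" where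
  "uniform_modulus U f w \<longleftrightarrow>
     mono_on {0..} w \<and> (w \<longlongrightarrow> 0) (at_right 0) \<and>
     (\<forall>u\<in>U. \<forall>x z. \<bar>f u (x + z) - f u x\<bar> \<le> w (norm z))"

text \<open>The modulus is integrated with respect to the total variation, which for nonnegative
  measures is the measure itself. For signed measures cancellation has to be excluded:
  the signed measures that put mass 1 at 0, 1/N at N and -1/N at -N on the real line converge
  weakly to the point mass at 0 and integrate the norm to 0, but they integrate the identity
  function to 2. Since a modulus is nonnegative on the nonnegative reals, the extended integral
  is the right one.\<close>

definition adapted_modulus ::
  "'w measure \<Rightarrow> (nat \<Rightarrow> 'w \<Rightarrow> 'a::real_normed_vector smeasure) \<Rightarrow> (real \<Rightarrow> real) \<Rightarrow> bool" where
  "adapted_modulus M \<mu> w \<longleftrightarrow>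
     (AE \<omega> in M. (\<lambda>N. tv_nn_integral (\<mu> N \<omega>) (\<lambda>z. ennreal (w (norm z)))) \<longlonglongrightarrow> 0)"

text \<open>A density is determined only up to null sets, so its symmetry, a statement about the
  lines parallel to the axes, is required for almost all of these lines.\<close>

definition symmetric_density :: "(real ^ 'm \<Rightarrow> real) \<Rightarrow> bool" where
  "symmetric_density K \<longleftrightarrow>
     K \<in> borel_measurable borel \<and> (\<forall>y. 0 \<le> K y) \<and> has_bochner_integral lborel K 1 \<and>
     (\<forall>l. AE y in lborel.
        has_bochner_integral lborel (\<lambda>t::real. t * K (\<chi> j. if j = l then t else y $ j)) 0)"

definition finite_positive_second_moment :: "(real ^ 'm \<Rightarrow> real) \<Rightarrow> bool" where
  "finite_positive_second_moment K \<longleftrightarrow>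
     integrable lborel (\<lambda>y. (norm y)\<^sup>2 * K y) \<and> 0 < (LINT y|lborel. (norm y)\<^sup>2 * K y)"


section \<open>Smoothed empirical objectives\<close>

definition conv_objective ::
  "('u \<Rightarrow> 'a::real_normed_vector \<Rightarrow> real) \<Rightarrow> (nat \<Rightarrow> 'w \<Rightarrow> 'a) \<Rightarrow> (nat \<Rightarrow> 'w \<Rightarrow> 'a smeasure) \<Rightarrow>
     nat \<Rightarrow> 'w \<Rightarrow> 'u \<Rightarrow> real" where
  "conv_objective F X \<mu> N \<omega> u =
     (\<Sum>i=1..N. sintegral (\<mu> N \<omega>) (\<lambda>z. F u (X i \<omega> + z))) / real N"

definition kernel_objective ::
  "('u \<Rightarrow> real ^ 'm \<Rightarrow> real) \<Rightarrow> (nat \<Rightarrow> 'w \<Rightarrow> real ^ 'm) \<Rightarrow> (real ^ 'm \<Rightarrow> real) \<Rightarrow>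
     (nat \<Rightarrow> real) \<Rightarrow> nat \<Rightarrow> 'w \<Rightarrow> 'u \<Rightarrow> real" where
  "kernel_objective F X K h N \<omega> u =
     (\<Sum>i=1..N. LINT x|lborel.
        F u x * K ((x - X i \<omega>) /\<^sub>R h N) * (1 / h N ^ CARD('m))) / real N"

end

theory Submission
  imports Defs
begin

text \<open>The smoothed objectives converge to the true objective uniformly on \<open>U\<close>, almost surely, and on
  a compact set uniform convergence of continuous objectives carries over to optimal values and
  optimal sets. Replacing the empirical objective by its smoothed version costs at most the
  integral of the modulus with respect to the total variation of the smoothing measure, whatever
  the sample. The empirical objectives themselves obey a uniform strong law.

  The strong law rests on the maximal ergodic inequality: if the mean is negative, then the partial
  sums cannot be unbounded above almost surely, so by Kolmogorov's 0-1 law they are bounded above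
  almost surely.\<close>

section \<open>The strong law of large numbers\<close>

text \<open>No moment beyond the first is assumed, so variance bounds would need truncation; the
  ergodic route avoids this. Its inequality concerns the mean of \<open>Y 0\<close> over the event
  that some partial sum is positive, and it says something about the full mean only if that event
  has probability one. The 0-1 law closes this gap: it leaves only the probabilities 0 and 1 for
  unboundedness above, and 1 would force a nonnegative mean. Subtracting a constant \<open>c\<close>
  slightly above the mean turns bounded partial sums into the estimate \<open>c + B / n\<close> for
  the averages; the sequence \<open>- Y\<close> gives the other side. Uniformity in \<open>u\<close>
  needs continuity of \<open>F\<close> in both variables jointly. Continuity in \<open>u\<close>
  alone does not give this; together with the modulus in \<open>x\<close> it does.\<close>

lemma (in prob_space) indep_sets_reindex:
  assumes f: "inj_on f I" and A: "indep_sets A (f ` I)"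
  shows "indep_sets (\<lambda>i. A (f i)) I"
proof (rule indep_setsI)
  show "A (f i) \<subseteq> events" if "i \<in> I" for i
    using A that by (auto simp: indep_sets_def)
next
  fix B J assume J: "J \<noteq> {}" "J \<subseteq> I" "finite J" and B: "\<forall>j\<in>J. B j \<in> A (f j)"
  have inj: "inj_on f J" using f J(2) by (rule inj_on_subset)
  \<comment> \<open>\<open>C\<close> relabels \<open>B\<close> by the image indices, which is
    unambiguous because \<open>f\<close> is injective on \<open>J\<close>.\<close>
  define C where "C = B \<circ> inv_into J f"
  have C: "C (f j) = B j" if "j \<in> J" for j
    using inj that by (simp add: C_def)
  have "prob (\<Inter>k\<in>f ` J. C k) = (\<Prod>k\<in>f ` J. prob (C k))"
    using J B C by (intro indep_setsD[OF A]) auto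
  also have "(\<Inter>k\<in>f ` J. C k) = (\<Inter>j\<in>J. B j)" using C by auto
  also have "(\<Prod>k\<in>f ` J. prob (C k)) = (\<Prod>j\<in>J. prob (B j))"
    using inj C by (simp add: prod.reindex)
  finally show "prob (\<Inter>j\<in>J. B j) = (\<Prod>j\<in>J. prob (B j))" .
qed

text \<open>With \<open>f = Suc\<close> this serves two ends: comparing a sequence with its shift,
  and passing from samples indexed from 1 to sequences indexed from 0.\<close>

lemma (in prob_space) indep_vars_reindex:
  assumes "inj_on f I" "indep_vars N X (f ` I)"
  shows "indep_vars (\<lambda>i. N (f i)) (\<lambda>i. X (f i)) I"
  using assms indep_sets_reindex[OF assms(1)] by (auto simp: indep_vars_def2)

text \<open>The maximum of the partial sums \<open>0, y 0, y 0 + y 1, \<dots>\<close> with at most \<open>n\<close> summands, in the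
  recursive form that the maximal ergodic inequality uses.\<close>

primrec max_sum :: "nat \<Rightarrow> (nat \<Rightarrow> real) \<Rightarrow> real" where
  "max_sum 0 y = 0"
| "max_sum (Suc n) y = max 0 (y 0 + max_sum n (\<lambda>i. y (Suc i)))"

lemma max_sum_nonneg: "0 \<le> max_sum n y"
  by (cases n) auto

lemma max_sum_Suc_mono: "max_sum n y \<le> max_sum (Suc n) y"
proof (induction n arbitrary: y)
  case (Suc n)
  show ?case using Suc[of "\<lambda>i. y (Suc i)"] by (auto simp del: max_sum.simps(2) simp: max_sum.simps(2)[of n] max_sum.simps(2)[of "Suc n"])
qed simp

lemma mono_max_sum: "mono (\<lambda>n. max_sum n y)"
  using max_sum_Suc_mono by (intro mono_iff_le_Suc[THEN iffD2]) auto

lemma sum_le_max_sum: "(\<Sum>i<n. y i) \<le> max_sum n y"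
proof (induction n arbitrary: y)
  case (Suc n)
  show ?case using Suc[of "\<lambda>i. y (Suc i)"] by (simp add: sum.lessThan_Suc_shift del: sum.lessThan_Suc)
qed simp

text \<open>Together with nonnegativity, this supplies the integrable majorant for the
  maxima.\<close>

lemma max_sum_le: "max_sum n y \<le> (\<Sum>i<n. \<bar>y i\<bar>)"
proof (induction n arbitrary: y)
  case (Suc n)
  show ?case using Suc[of "\<lambda>i. y (Suc i)"] max_sum_nonneg[of n "\<lambda>i. y (Suc i)"]
    by (simp add: sum.lessThan_Suc_shift del: sum.lessThan_Suc)
qed simp

lemma measurable_max_sum [measurable]: "max_sum n \<in> borel_measurable (PiM UNIV (\<lambda>_. borel))"
proof (induction n)
  case (Suc n)
  have shift: "(\<lambda>y i. y (Suc i)) \<in> measurable (PiM UNIV (\<lambda>_. borel)) (PiM UNIV (\<lambda>_. borel :: real measure))"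
    by (rule measurable_PiM_single') (auto simp: space_PiM)
  have [measurable]: "(\<lambda>y. max_sum n (\<lambda>i. y (Suc i))) \<in> borel_measurable (PiM UNIV (\<lambda>_. borel))"
    using measurable_compose[OF shift Suc] .
  show ?case by simp measurable
qed simp

text \<open>Dropping the first \<open>n\<close> summands changes all later partial sums by the same
  constant. This makes unboundedness a tail event; natural bounds keep the quantifiers
  countable.\<close>

lemma partial_sums_unbounded_shift:
  fixes y :: "nat \<Rightarrow> real"
  shows "(\<forall>B::nat. \<exists>k. real B < (\<Sum>i=n..<k. y i)) \<longleftrightarrow> (\<forall>B::nat. \<exists>k. real B < (\<Sum>i<k. y i))"
proof (induction n)
  case 0
  show ?case by (simp add: atLeast0LessThan)
next
  case (Suc n)
  have split: "(\<Sum>i=n..<k. y i) = y n + (\<Sum>i=Suc n..<k. y i)" if "n < k" for k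
    using that by (simp add: sum.atLeast_Suc_lessThan)
  have "(\<exists>k. real B < (\<Sum>i=n..<k. y i))" if *: "\<forall>B::nat. \<exists>k. real B < (\<Sum>i=Suc n..<k. y i)" for B
  proof -
    \<comment> \<open>The larger bound absorbs the summand \<open>y n\<close>, whatever its
      sign.\<close>
    obtain B' where B': "real B + \<bar>y n\<bar> \<le> real B'" using real_arch_simple by blast
    from * obtain k where k: "real B' < (\<Sum>i=Suc n..<k. y i)" by blast
    \<comment> \<open>Otherwise the sum would be empty, hence 0, and could not exceed
      \<open>real B'\<close>.\<close>
    then have "n < k" by (cases "n < k") auto
    with k B' split[of k] show ?thesis by (intro exI[of _ k]) linarith
  qed
  moreover have "(\<exists>k. real B < (\<Sum>i=Suc n..<k. y i))" if *: "\<forall>B::nat. \<exists>k. real B < (\<Sum>i=n..<k. y i)" for B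
  proof -
    obtain B' where B': "real B + \<bar>y n\<bar> \<le> real B'" using real_arch_simple by blast
    from * obtain k where k: "real B' < (\<Sum>i=n..<k. y i)" by blast
    then have "n < k" by (cases "n < k") auto
    with k B' split[of k] show ?thesis by (intro exI[of _ k]) linarith
  qed
  ultimately have "(\<forall>B::nat. \<exists>k. real B < (\<Sum>i=Suc n..<k. y i)) \<longleftrightarrow> (\<forall>B::nat. \<exists>k. real B < (\<Sum>i=n..<k. y i))"
    by iprover
  then show ?case using Suc.IH by (rule trans)
qed

section \<open>The ergodic argument for an i.i.d. sequence\<close>

locale iid_sequence = prob_space +
  fixes Y :: "nat \<Rightarrow> 'a \<Rightarrow> real"
  assumes indep: "indep_vars (\<lambda>_. borel) Y UNIV"
    and ident: "distr M borel (Y i) = distr M borel (Y 0)"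
    and integrable_0: "integrable M (Y 0)"
begin

lemma measurable_Y [measurable]: "Y i \<in> borel_measurable M"
  using indep by (auto simp: indep_vars_def)

lemma integrable_Y: "integrable M (Y i)"
proof -
  have "integrable (distr M borel (Y 0)) (\<lambda>x. x)"
    using integrable_0 by (simp add: integrable_distr_eq)
  then have "integrable (distr M borel (Y i)) (\<lambda>x. x)" by (simp only: ident[of i])
  then show ?thesis by (simp add: integrable_distr_eq)
qed

text \<open>Independence makes both joint laws products of their marginals, and the marginals agree.
  This stationarity is the measure preservation behind the maximal inequality.\<close>

lemma distr_shift:
  "distr M (PiM UNIV (\<lambda>_. borel)) (\<lambda>\<omega> i. Y (Suc i) \<omega>) = distr M (PiM UNIV (\<lambda>_. borel)) (\<lambda>\<omega> i. Y i \<omega>)"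
proof -
  have "indep_vars (\<lambda>_. borel) (\<lambda>i. Y (Suc i)) UNIV"
    using indep_vars_reindex[of Suc UNIV "\<lambda>_. borel" Y] indep_vars_subset[OF indep, of "range Suc"] by simp
  moreover have "(\<lambda>i. distr M borel (Y (Suc i))) = (\<lambda>i. distr M borel (Y i))"
    using ident[of "Suc _"] ident by metis
  ultimately show ?thesis
    using indep_vars_iff_distr_eq_PiM'[where I = UNIV and M' = "\<lambda>_. borel" and X = "\<lambda>i. Y (Suc i)"]
      indep_vars_iff_distr_eq_PiM'[where I = UNIV and M' = "\<lambda>_. borel" and X = Y] indep by (simp add: restrict_UNIV)
qed

lemma measurable_seq [measurable]: "(\<lambda>\<omega> i. Y (f i) \<omega>) \<in> measurable M (PiM UNIV (\<lambda>_. borel))"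
  by (rule measurable_PiM_single') auto

lemma integrable_max_sum: "integrable M (\<lambda>\<omega>. max_sum n (\<lambda>i. Y (f i) \<omega>))"
proof (rule Bochner_Integration.integrable_bound)
  show "integrable M (\<lambda>\<omega>. \<Sum>i<n. \<bar>Y (f i) \<omega>\<bar>)" by (auto intro!: integrable_Y)
  show "AE \<omega> in M. norm (max_sum n (\<lambda>i. Y (f i) \<omega>)) \<le> norm (\<Sum>i<n. \<bar>Y (f i) \<omega>\<bar>)"
    using max_sum_le max_sum_nonneg by (intro AE_I2) (auto intro: order_trans)
qed measurable

text \<open>Where \<open>max_sum n Y\<close> is positive, \<open>Y 0\<close> is at least \<open>max_sum n Y\<close> minus its shift, and the
  expectation of this difference vanishes because the shifted sequence has the same law.\<close>

lemma maximal_inequality: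
  "0 \<le> expectation (\<lambda>\<omega>. Y 0 \<omega> * indicator {\<omega>. 0 < max_sum n (\<lambda>i. Y i \<omega>)} \<omega>)"
proof (cases n)
  case (Suc k)
  have int: "integrable M (\<lambda>\<omega>. max_sum n (\<lambda>i. Y i \<omega>))" "integrable M (\<lambda>\<omega>. max_sum n (\<lambda>i. Y (Suc i) \<omega>))"
    using integrable_max_sum[of n "\<lambda>i. i"] integrable_max_sum[of n Suc] by auto
  have "expectation (\<lambda>\<omega>. max_sum n (\<lambda>i. Y (Suc i) \<omega>)) = expectation (\<lambda>\<omega>. max_sum n (\<lambda>i. Y i \<omega>))"
    using integral_distr[OF measurable_seq measurable_max_sum, of Suc n]
      integral_distr[OF measurable_seq measurable_max_sum, of "\<lambda>i. i" n] distr_shift by simp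
  then have "0 = expectation (\<lambda>\<omega>. max_sum n (\<lambda>i. Y i \<omega>) - max_sum n (\<lambda>i. Y (Suc i) \<omega>))"
    using int by simp
  also have "\<dots> \<le> expectation (\<lambda>\<omega>. Y 0 \<omega> * indicator {\<omega>. 0 < max_sum n (\<lambda>i. Y i \<omega>)} \<omega>)"
  proof (rule integral_mono)
    show "integrable M (\<lambda>\<omega>. Y 0 \<omega> * indicator {\<omega>. 0 < max_sum n (\<lambda>i. Y i \<omega>)} \<omega>)"
    proof (rule Bochner_Integration.integrable_bound[OF integrable_0])
      show "(\<lambda>\<omega>. Y 0 \<omega> * indicator {\<omega>. 0 < max_sum n (\<lambda>i. Y i \<omega>)} \<omega>) \<in> borel_measurable M"
        using measurable_seq[of "\<lambda>i. i"] by (auto simp: indicator_def)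
    qed (auto simp: indicator_def)
    \<comment> \<open>On the event, the recursion yields \<open>Y 0\<close> plus the shifted maximum
      with index \<open>k\<close>, and monotonicity raises that index to \<open>n\<close>. Off the
      event, the first maximum is 0 and the second is nonnegative.\<close>
    show "max_sum n (\<lambda>i. Y i \<omega>) - max_sum n (\<lambda>i. Y (Suc i) \<omega>)
        \<le> Y 0 \<omega> * indicator {\<omega>. 0 < max_sum n (\<lambda>i. Y i \<omega>)} \<omega>" for \<omega>
      using max_sum_Suc_mono[of k "\<lambda>i. Y (Suc i) \<omega>"] max_sum_nonneg[of k "\<lambda>i. Y (Suc i) \<omega>"] max_sum_nonneg[of n "\<lambda>i. Y (Suc i) \<omega>"]
      unfolding Suc by (auto simp: indicator_def)
  qed (use int in auto)
  finally show ?thesis .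
qed simp

lemma prob_unbounded_0_1:
  fixes A
  defines "A \<equiv> {\<omega>\<in>space M. \<forall>B::nat. \<exists>k. real B < (\<Sum>i<k. Y i \<omega>)}"
  shows "prob A = 0 \<or> prob A = 1"
proof (rule kolmogorov_0_1_law)
  let ?A = "\<lambda>i. sigma_sets (space M) {Y i -` B \<inter> space M | B. B \<in> sets borel}"
  show "sigma_algebra (space M) (?A i)" for i by (rule sigma_algebra_sigma_sets) auto
  show "indep_sets ?A UNIV" using indep by (simp add: indep_vars_def)
  show "A \<in> tail_events ?A"
    unfolding tail_events_def
  proof
    fix n
    let ?T = "sigma (space M) (\<Union> (?A ` {n..}))"
    have sub: "\<Union> (?A ` {n..}) \<subseteq> Pow (space M)"
      by (auto dest!: sigma_sets_into_sp[rotated])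
    have [measurable]: "Y i \<in> borel_measurable ?T" if "n \<le> i" for i
      using that sub by (intro measurableI) (auto simp: space_measure_of_conv intro!: sigma_sets.Basic exI)
    have [measurable]: "(\<lambda>\<omega>. \<Sum>i=n..<k. Y i \<omega>) \<in> borel_measurable ?T" for k
      by (intro borel_measurable_sum) auto
    \<comment> \<open>In this form the event involves only variables with index at least
      \<open>n\<close>.\<close>
    have "A = {\<omega>\<in>space ?T. \<forall>B::nat. \<exists>k. real B < (\<Sum>i=n..<k. Y i \<omega>)}"
      by (simp add: A_def partial_sums_unbounded_shift space_measure_of_conv)
    also have "\<dots> \<in> sets ?T" by measurable
    finally show "A \<in> sigma_sets (space M) (\<Union> (?A ` {n..}))"
      using sub by simp
  qed
qed

lemma AE_partial_sums_bounded:
  assumes neg: "expectation (Y 0) < 0"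
  shows "AE \<omega> in M. \<exists>B::nat. \<forall>k. (\<Sum>i<k. Y i \<omega>) \<le> real B"
proof -
  define A where "A = {\<omega>\<in>space M. \<forall>B::nat. \<exists>k. real B < (\<Sum>i<k. Y i \<omega>)}"
  have A: "A \<in> events" unfolding A_def by measurable
  have "prob A \<noteq> 1"
  proof
    assume "prob A = 1"
    then have AE: "AE \<omega> in M. \<omega> \<in> A" using A by (simp add: prob_eq_1)
    \<comment> \<open>Under the assumption \<open>prob A = 1\<close> the indicators increase to 1
      almost surely, so the nonnegative terms of the maximal inequality pass to the mean.\<close>
    have "(\<lambda>n. expectation (\<lambda>\<omega>. Y 0 \<omega> * indicator {\<omega>. 0 < max_sum n (\<lambda>i. Y i \<omega>)} \<omega>)) \<longlonglongrightarrow> expectation (Y 0)"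
    proof (rule integral_dominated_convergence)
      show "integrable M (\<lambda>\<omega>. \<bar>Y 0 \<omega>\<bar>)" using integrable_0 by simp
      show "(\<lambda>\<omega>. Y 0 \<omega> * indicator {\<omega>. 0 < max_sum n (\<lambda>i. Y i \<omega>)} \<omega>) \<in> borel_measurable M" for n
        using measurable_seq[of "\<lambda>i. i"] by (auto simp: indicator_def)
      show "AE \<omega> in M. (\<lambda>n. Y 0 \<omega> * indicator {\<omega>. 0 < max_sum n (\<lambda>i. Y i \<omega>)} \<omega>) \<longlonglongrightarrow> Y 0 \<omega>"
        using AE
      proof eventually_elim
        case (elim \<omega>)
        \<comment> \<open>Only the bound \<open>B = 0\<close> is used: a single positive partial sum
          keeps all later maxima positive.\<close>
        then obtain k where "real 0 < (\<Sum>i<k. Y i \<omega>)" unfolding A_def by blast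
        then have k: "0 < max_sum k (\<lambda>i. Y i \<omega>)" using sum_le_max_sum[of "\<lambda>i. Y i \<omega>" k] by simp
        show ?case
        proof (rule tendsto_eventually, rule eventually_sequentiallyI[of k])
          fix n assume "k \<le> n"
          with k have "0 < max_sum n (\<lambda>i. Y i \<omega>)" using monoD[OF mono_max_sum] less_le_trans by blast
          then show "Y 0 \<omega> * indicator {\<omega>. 0 < max_sum n (\<lambda>i. Y i \<omega>)} \<omega> = Y 0 \<omega>" by simp
        qed
      qed
    qed (auto simp: indicator_def)
    then have "0 \<le> expectation (Y 0)"
      by (rule tendsto_lowerbound) (auto simp: maximal_inequality)
    with neg show False by simp
  qed
  then have "prob A = 0" using prob_unbounded_0_1 unfolding A_def by blast
  then have "AE \<omega> in M. \<omega> \<notin> A" using A by (simp add: prob_eq_0)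
  with AE_space show ?thesis by eventually_elim (auto simp: A_def not_less)
qed

end

text \<open>For \<open>c\<close> strictly between the mean and \<open>m\<close>, the sums of
  \<open>Y i - c\<close> have negative drift and are bounded by some \<open>B\<close>. The averages
  are then at most \<open>c + B / n\<close>, and the gap \<open>m - c\<close> eventually exceeds
  \<open>B / n\<close>.\<close>

lemma (in prob_space) AE_averages_eventually_less:
  assumes "iid_sequence M Y" and m: "expectation (Y 0) < m"
  shows "AE \<omega> in M. \<forall>\<^sub>F n in sequentially. (\<Sum>i<n. Y i \<omega>) / real n < m"
proof -
  interpret Y: iid_sequence M Y by fact
  obtain c where c: "expectation (Y 0) < c" "c < m" using dense m by blast
  interpret Z: iid_sequence M "\<lambda>i \<omega>. Y i \<omega> - c"
  proof
    show "indep_vars (\<lambda>_. borel) (\<lambda>i \<omega>. Y i \<omega> - c) UNIV"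
      by (rule indep_vars_compose2[OF Y.indep]) auto
    have "distr M borel (\<lambda>\<omega>. Y i \<omega> - c) = distr (distr M borel (Y i)) borel (\<lambda>x. x - c)" for i
      by (subst distr_distr) (auto simp: o_def)
    then show "distr M borel (\<lambda>\<omega>. Y i \<omega> - c) = distr M borel (\<lambda>\<omega>. Y 0 \<omega> - c)" for i
      by (simp add: Y.ident[of i])
    show "integrable M (\<lambda>\<omega>. Y 0 \<omega> - c)" using Y.integrable_0 by simp
  qed
  have "expectation (\<lambda>\<omega>. Y 0 \<omega> - c) < 0" using c(1) Y.integrable_0 by (simp add: prob_space)
  from Z.AE_partial_sums_bounded[OF this] show ?thesis
  proof eventually_elim
    case (elim \<omega>)
    then obtain B :: nat where B: "\<And>k. (\<Sum>i<k. Y i \<omega> - c) \<le> real B" by blast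
    have "(\<lambda>n. real B / real n) \<longlonglongrightarrow> 0" by (rule lim_const_over_n)
    then have "\<forall>\<^sub>F n in sequentially. real B / real n < m - c"
      using c(2) by (intro order_tendstoD) auto
    with eventually_gt_at_top[of 0] show ?case
    proof eventually_elim
      case (elim n)
      have "(\<Sum>i<n. Y i \<omega>) \<le> real B + real n * c"
        using B[of n] by (simp add: sum_subtractf)
      with elim show ?case by (auto simp: field_simps)
    qed
  qed
qed

text \<open>The one-sided estimate is applied to \<open>Y\<close> and to \<open>- Y\<close>. The
  tolerances \<open>1 / Suc j\<close> keep the number of exceptional null sets countable.\<close>

lemma (in prob_space) strong_law_of_large_numbers:
  assumes "iid_sequence M Y"
  shows "AE \<omega> in M. (\<lambda>n. (\<Sum>i<n. Y i \<omega>) / real n) \<longlonglongrightarrow> expectation (Y 0)"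
proof -
  interpret Y: iid_sequence M Y by fact
  have neg: "iid_sequence M (\<lambda>i \<omega>. - Y i \<omega>)"
  proof
    show "indep_vars (\<lambda>_. borel) (\<lambda>i \<omega>. - Y i \<omega>) UNIV"
      by (rule indep_vars_compose2[OF Y.indep]) auto
    have "distr M borel (\<lambda>\<omega>. - Y i \<omega>) = distr (distr M borel (Y i)) borel uminus" for i
      by (subst distr_distr) (auto simp: o_def)
    then show "distr M borel (\<lambda>\<omega>. - Y i \<omega>) = distr M borel (\<lambda>\<omega>. - Y 0 \<omega>)" for i
      by (simp add: Y.ident[of i])
    show "integrable M (\<lambda>\<omega>. - Y 0 \<omega>)" using Y.integrable_0 by simp
  qed
  let ?e = "\<lambda>j. 1 / real (Suc j)"
  have "AE \<omega> in M. \<forall>j. \<forall>\<^sub>F n in sequentially. (\<Sum>i<n. Y i \<omega>) / real n < expectation (Y 0) + ?e j"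
    by (subst AE_all_countable) (auto intro!: AE_averages_eventually_less assms)
  moreover have "AE \<omega> in M. \<forall>j. \<forall>\<^sub>F n in sequentially.
      (\<Sum>i<n. - Y i \<omega>) / real n < - expectation (Y 0) + ?e j"
    by (subst AE_all_countable) (auto intro!: AE_averages_eventually_less[OF neg])
  ultimately show ?thesis
  proof eventually_elim
    case (elim \<omega>)
    show ?case
    proof (rule tendstoI)
      fix e :: real assume "0 < e"
      then obtain j where j: "?e j < e" using nat_approx_posE by blast
      from elim(1)[rule_format, of j] elim(2)[rule_format, of j]
      show "\<forall>\<^sub>F n in sequentially. dist ((\<Sum>i<n. Y i \<omega>) / real n) (expectation (Y 0)) < e"
        by eventually_elim (use j in \<open>auto simp: dist_real_def sum_negf\<close>)
    qed
  qed
qed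

text \<open>The sample is tied to \<open>X0\<close> only through its law, so integrability and the
  mean of \<open>f\<close> are carried over through the distribution.\<close>

lemma (in prob_space) AE_sample_averages:
  fixes X :: "nat \<Rightarrow> 'a \<Rightarrow> 'b::topological_space"
  assumes indep: "indep_vars (\<lambda>_. borel) X {1..}"
    and ident: "\<And>i. i \<ge> 1 \<Longrightarrow> distr M borel (X i) = distr M borel X0"
    and X0 [measurable]: "X0 \<in> borel_measurable M"
    and f [measurable]: "f \<in> borel_measurable borel"
    and int: "integrable M (\<lambda>\<omega>. f (X0 \<omega>))"
  shows "AE \<omega> in M. (\<lambda>N. (\<Sum>i=1..N. f (X i \<omega>)) / real N) \<longlonglongrightarrow> expectation (\<lambda>\<omega>. f (X0 \<omega>))"
proof -
  have [measurable]: "X (Suc i) \<in> borel_measurable M" for i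
    using indep by (auto simp: indep_vars_def)
  have distr: "distr M borel (\<lambda>\<omega>. f (X (Suc i) \<omega>)) = distr (distr M borel X0) borel f" for i
    by (subst ident[of "Suc i", symmetric]) (auto simp: distr_distr o_def)
  have "integrable (distr M borel X0) f" "integral\<^sup>L (distr M borel X0) f = expectation (\<lambda>\<omega>. f (X0 \<omega>))"
    using int by (auto simp: integrable_distr_eq integral_distr)
  then have "integrable M (\<lambda>\<omega>. f (X (Suc 0) \<omega>))"
      "expectation (\<lambda>\<omega>. f (X (Suc 0) \<omega>)) = expectation (\<lambda>\<omega>. f (X0 \<omega>))"
    using ident[of "Suc 0"]
      integrable_distr_eq[of "X (Suc 0)" M borel f] integral_distr[of "X (Suc 0)" M borel f] by auto
  moreover have "indep_vars (\<lambda>_. borel) (\<lambda>i. X (Suc i)) UNIV"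
    using indep by (intro indep_vars_reindex[of Suc UNIV "\<lambda>_. borel" X, simplified])
      (auto elim!: indep_vars_subset)
  then have "indep_vars (\<lambda>_. borel) (\<lambda>i \<omega>. f (X (Suc i) \<omega>)) UNIV"
    by (rule indep_vars_compose2) auto
  ultimately have "iid_sequence M (\<lambda>i \<omega>. f (X (Suc i) \<omega>))"
    by unfold_locales (simp_all add: distr)
  from strong_law_of_large_numbers[OF this] show ?thesis
    by (simp add: sum.atLeast1_atMost_eq \<open>expectation (\<lambda>\<omega>. f (X (Suc 0) \<omega>)) = _\<close>)
qed

text \<open>On a large ball the integrands are uniformly
  equicontinuous in \<open>u\<close>, and outside of it the envelope has small mean. Hence the strong law is
  needed only for countably many functions.\<close>

lemma (in prob_space) uniform_strong_law:
  fixes X :: "nat \<Rightarrow> 'a \<Rightarrow> 'b::euclidean_space"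
    and F :: "'u::{metric_space,second_countable_topology} \<Rightarrow> 'b \<Rightarrow> real"
  assumes indep: "indep_vars (\<lambda>_. borel) X {1..}"
    and ident: "\<And>i. i \<ge> 1 \<Longrightarrow> distr M borel (X i) = distr M borel X0"
    and X0 [measurable]: "X0 \<in> borel_measurable M"
    and U: "compact U"
    and cont: "continuous_on (U \<times> UNIV) (\<lambda>(u, x). F u x)"
    and g [measurable]: "g \<in> borel_measurable borel" "integrable M (\<lambda>\<omega>. g (X0 \<omega>))"
    and env: "\<And>u x. u \<in> U \<Longrightarrow> \<bar>F u x\<bar> \<le> g x"
  shows "AE \<omega> in M. uniform_limit U (\<lambda>N u. (\<Sum>i=1..N. F u (X i \<omega>)) / real N)
    (\<lambda>u. expectation (\<lambda>\<omega>. F u (X0 \<omega>))) sequentially"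
proof -
  have F_meas [measurable]: "F u \<in> borel_measurable borel" if "u \<in> U" for u
  proof (rule borel_measurable_continuous_onI)
    have "continuous_on UNIV (\<lambda>x. case (u, x) of (u, x) \<Rightarrow> F u x)"
      by (rule continuous_on_compose2[OF cont]) (use that in \<open>auto intro!: continuous_intros\<close>)
    then show "continuous_on UNIV (F u)" by simp
  qed
  have F_int: "integrable M (\<lambda>\<omega>. F u (X0 \<omega>))" if "u \<in> U" for u
    using that env[OF that] by (intro Bochner_Integration.integrable_bound[OF g(2)])
      (auto intro: order_trans[OF _ abs_ge_self])
  obtain D where D: "countable D" "D \<subseteq> U" "U \<subseteq> closure D" using separable by blast
  \<comment> \<open>The part of the envelope outside the ball of radius \<open>R\<close>. It
    replaces equicontinuity where compactness fails, and its own averages obey the strong law, for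
    all \<open>R\<close> simultaneously.\<close>
  define t where "t R x = \<bar>g x\<bar> * indicator {x. real R < norm x} x" for R :: nat and x
  have t_meas [measurable]: "t R \<in> borel_measurable borel" for R
    unfolding t_def by measurable
  have t_int: "integrable M (\<lambda>\<omega>. t R (X0 \<omega>))" for R
    by (rule Bochner_Integration.integrable_bound[OF g(2)]) (auto simp: t_def indicator_def)
  have t_lim: "(\<lambda>R. expectation (\<lambda>\<omega>. t R (X0 \<omega>))) \<longlonglongrightarrow> expectation (\<lambda>\<omega>. 0)"
  proof (rule integral_dominated_convergence)
    show "integrable M (\<lambda>\<omega>. \<bar>g (X0 \<omega>)\<bar>)" using g(2) by simp
    show "AE \<omega> in M. (\<lambda>R. t R (X0 \<omega>)) \<longlonglongrightarrow> 0"
    proof (rule AE_I2)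
      fix \<omega>
      obtain n where "norm (X0 \<omega>) \<le> real n" using real_arch_simple by blast
      then have "\<forall>\<^sub>F R in sequentially. t R (X0 \<omega>) = 0"
        by (intro eventually_sequentiallyI[of n]) (auto simp: t_def indicator_def)
      then show "(\<lambda>R. t R (X0 \<omega>)) \<longlonglongrightarrow> 0" by (rule tendsto_eventually)
    qed
  qed (auto simp: t_def indicator_def)
  let ?avg = "\<lambda>N f \<omega>. (\<Sum>i=1..N. f (X i \<omega>)) / real N"
  have "AE \<omega> in M. \<forall>u\<in>D. (\<lambda>N. ?avg N (F u) \<omega>) \<longlonglongrightarrow> expectation (\<lambda>\<omega>. F u (X0 \<omega>))"
    unfolding AE_ball_countable[OF D(1)]
  proof
    fix u assume "u \<in> D"
    with D(2) have "u \<in> U" by blast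
    then show "AE \<omega> in M. (\<lambda>N. ?avg N (F u) \<omega>) \<longlonglongrightarrow> expectation (\<lambda>\<omega>. F u (X0 \<omega>))"
      by (intro AE_sample_averages[OF indep ident X0] F_meas F_int)
  qed
  moreover have "AE \<omega> in M. \<forall>R. (\<lambda>N. ?avg N (t R) \<omega>) \<longlonglongrightarrow> expectation (\<lambda>\<omega>. t R (X0 \<omega>))"
    unfolding AE_all_countable by (intro allI AE_sample_averages[OF indep ident X0] t_meas t_int)
  ultimately show ?thesis
  proof eventually_elim
    case (elim \<omega>)
    show ?case
    proof (rule uniform_limitI)
      fix \<epsilon> :: real assume "0 < \<epsilon>"
      \<comment> \<open>Moving from \<open>u\<close> to a net point costs less than
        \<open>3 * e\<close> in the averages and less than \<open>3 * e\<close> in the expectations,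
        namely \<open>e\<close> plus twice a tail below \<open>e\<close>; the strong law at the net
        point costs one more \<open>e\<close>.\<close>
      define e where "e = \<epsilon> / 7"
      have e: "0 < e" using \<open>0 < \<epsilon>\<close> by (simp add: e_def)
      obtain R where R: "expectation (\<lambda>\<omega>. t R (X0 \<omega>)) < e"
        using order_tendstoD(2)[OF t_lim, of e] e by (auto simp: eventually_sequentially)
      have "uniformly_continuous_on (U \<times> cball 0 (real R)) (\<lambda>(u, x). F u x)"
        by (intro compact_uniformly_continuous continuous_on_subset[OF cont] compact_Times U) auto
      then obtain \<delta> where \<delta>: "0 < \<delta>"
        "\<And>p q. p \<in> U \<times> cball 0 (real R) \<Longrightarrow> q \<in> U \<times> cball 0 (real R) \<Longrightarrow> dist q p < \<delta> \<Longrightarrow>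
          dist (case q of (u, x) \<Rightarrow> F u x) (case p of (u, x) \<Rightarrow> F u x) < e"
        unfolding uniformly_continuous_on_def using e by metis
      \<comment> \<open>Inside the ball the tail term is 0 and uniform continuity applies; outside,
        both values are bounded by the envelope.\<close>
      have close: "\<bar>F u x - F v x\<bar> \<le> e + 2 * t R x" if "u \<in> U" "v \<in> U" "dist u v < \<delta>" for u v x
      proof (cases "norm x \<le> real R")
        case True
        then show ?thesis
          using \<delta>(2)[of "(v, x)" "(u, x)"] that by (simp add: dist_Pair_Pair dist_real_def t_def)
      next
        case False
        then show ?thesis using env[OF that(1), of x] env[OF that(2), of x] e
          by (simp add: t_def)
      qed
      have "U \<subseteq> (\<Union>d\<in>D. ball d \<delta>)"
        using D(3) \<delta>(1) by (force simp: closure_approachable)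
      \<comment> \<open>The centres lie in \<open>D\<close>, where almost sure convergence is
        already secured; finiteness gives a common index from which it is
        \<open>e\<close>-accurate.\<close>
      then obtain T where T: "T \<subseteq> D" "finite T" "U \<subseteq> (\<Union>d\<in>T. ball d \<delta>)"
        using compactE_image[OF U, of D "\<lambda>d. ball d \<delta>"] by auto
      have "\<forall>\<^sub>F N in sequentially. \<forall>d\<in>T. dist (?avg N (F d) \<omega>) (expectation (\<lambda>\<omega>. F d (X0 \<omega>))) < e"
        using elim(1) T(1,2) e by (intro eventually_ball_finite) (auto intro: tendstoD)
      moreover have "\<forall>\<^sub>F N in sequentially. ?avg N (t R) \<omega> < e"
        using elim(2) R by (auto intro: order_tendstoD(2))
      moreover have "\<forall>\<^sub>F N :: nat in sequentially. 0 < N" by (rule eventually_gt_at_top)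
      ultimately show "\<forall>\<^sub>F N in sequentially. \<forall>u\<in>U.
          dist (?avg N (F u) \<omega>) (expectation (\<lambda>\<omega>. F u (X0 \<omega>))) < \<epsilon>"
      proof eventually_elim
        case (elim N)
        show ?case
        proof
          fix u assume u: "u \<in> U"
          then obtain d where d: "d \<in> T" "dist u d < \<delta>" using T(3) by (auto simp: dist_commute)
          then have "d \<in> U" using T(1) D(2) by auto
          note close = close[OF u this d(2)]
          have "\<bar>?avg N (F u) \<omega> - ?avg N (F d) \<omega>\<bar> = \<bar>\<Sum>i=1..N. F u (X i \<omega>) - F d (X i \<omega>)\<bar> / real N"
            by (simp add: sum_subtractf diff_divide_distrib[symmetric])
          also have "\<dots> \<le> (\<Sum>i=1..N. e + 2 * t R (X i \<omega>)) / real N"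
            by (intro divide_right_mono order_trans[OF sum_abs] sum_mono close) auto
          also have "\<dots> = e + 2 * ?avg N (t R) \<omega>"
            using elim(3) by (simp add: sum.distrib sum_distrib_left[symmetric] add_divide_distrib)
          finally have 1: "\<bar>?avg N (F u) \<omega> - ?avg N (F d) \<omega>\<bar> \<le> e + 2 * ?avg N (t R) \<omega>" .
          have "\<bar>expectation (\<lambda>\<omega>. F u (X0 \<omega>)) - expectation (\<lambda>\<omega>. F d (X0 \<omega>))\<bar>
              = \<bar>expectation (\<lambda>\<omega>. F u (X0 \<omega>) - F d (X0 \<omega>))\<bar>"
            using F_int u \<open>d \<in> U\<close> by simp
          also have "\<dots> \<le> expectation (\<lambda>\<omega>. \<bar>F u (X0 \<omega>) - F d (X0 \<omega>)\<bar>)"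
            by (rule integral_abs_bound)
          also have "\<dots> \<le> expectation (\<lambda>\<omega>. e + 2 * t R (X0 \<omega>))"
            using F_int u \<open>d \<in> U\<close> t_int by (intro integral_mono close) auto
          also have "\<dots> = e + 2 * expectation (\<lambda>\<omega>. t R (X0 \<omega>))"
            using t_int by (simp add: prob_space)
          finally have 2: "\<bar>expectation (\<lambda>\<omega>. F u (X0 \<omega>)) - expectation (\<lambda>\<omega>. F d (X0 \<omega>))\<bar>
              \<le> e + 2 * expectation (\<lambda>\<omega>. t R (X0 \<omega>))" .
          have "dist (?avg N (F d) \<omega>) (expectation (\<lambda>\<omega>. F d (X0 \<omega>))) < e" using elim(1) d(1) by blast
          moreover have "\<epsilon> = 7 * e" by (simp add: e_def)
          ultimately show "dist (?avg N (F u) \<omega>) (expectation (\<lambda>\<omega>. F u (X0 \<omega>))) < \<epsilon>"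
            using 1 2 elim(2) R unfolding dist_real_def by linarith
        qed
      qed
    qed
  qed
qed

section \<open>Stability of optimal values and optimal sets\<close>

lemma opt_value_eq:
  assumes "u \<in> opt_set U \<phi>"
  shows "opt_value U \<phi> = \<phi> u"
  unfolding opt_value_def using assms by (intro Least_equality) (auto simp: opt_set_def)

lemma opt_set_nonempty:
  fixes \<phi> :: "'a::topological_space \<Rightarrow> real"
  assumes "compact U" "U \<noteq> {}" "continuous_on U \<phi>"
  obtains u where "u \<in> opt_set U \<phi>"
  using continuous_attains_inf[OF assms] by (auto simp: opt_set_def)

text \<open>Deviations are extended nonnegative numbers. Below any positive one lies a positive
  finite one, so real tolerances suffice.\<close>

lemma tendsto_0_ennrealI:
  assumes "\<And>e. 0 < e \<Longrightarrow> \<forall>\<^sub>F n in G. f n \<le> ennreal e"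
  shows "(f \<longlongrightarrow> 0) G"
proof (rule order_tendstoI)
  fix a :: ennreal assume "0 < a"
  then obtain b where b: "0 < b" "b < a" using dense by blast
  then obtain r where r: "b = ennreal r" "0 < r"
    by (cases b) (auto simp: less_top[symmetric])
  show "\<forall>\<^sub>F n in G. f n < a"
    using assms[OF r(2)] b r by (auto elim!: eventually_mono)
qed auto

text \<open>A minimizer \<open>u\<close> of \<open>\<phi> N\<close> and a minimizer \<open>v\<close>
  of \<open>\<psi>\<close> are compared crosswise: each is a competitor in the other problem, so
  uniform closeness bounds the difference of the minima from both sides.\<close>

lemma uniform_limit_opt_value:
  fixes \<phi> :: "nat \<Rightarrow> 'a::topological_space \<Rightarrow> real"
  assumes U: "compact U" "U \<noteq> {}"
    and cont: "\<forall>\<^sub>F N in sequentially. continuous_on U (\<phi> N)"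
    and lim: "uniform_limit U \<phi> \<psi> sequentially"
  shows "(\<lambda>N. opt_value U (\<phi> N)) \<longlonglongrightarrow> opt_value U \<psi>"
proof -
  have "continuous_on U \<psi>" using uniform_limit_theorem[OF cont lim] by simp
  then obtain v where v: "v \<in> opt_set U \<psi>" using opt_set_nonempty[OF U] by blast
  show ?thesis
  proof (rule tendstoI)
    fix e :: real assume "0 < e"
    from uniform_limitD[OF lim this] cont
    show "\<forall>\<^sub>F N in sequentially. dist (opt_value U (\<phi> N)) (opt_value U \<psi>) < e"
    proof eventually_elim
      case (elim N)
      obtain u where u: "u \<in> opt_set U (\<phi> N)" using opt_set_nonempty[OF U elim(2)] .
      have "\<phi> N u \<le> \<phi> N v" "\<psi> v \<le> \<psi> u" "u \<in> U" "v \<in> U" using u v by (auto simp: opt_set_def)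
      with elim(1)[rule_format, of u] elim(1)[rule_format, of v] show ?case
        unfolding opt_value_eq[OF u] opt_value_eq[OF v] dist_real_def by linarith
    qed
  qed
qed

text \<open>Outside the open \<open>e\<close>-neighbourhood of the limiting minimizers, compactness
  forces a gap \<open>\<gamma>\<close> above the minimum of \<open>\<psi>\<close>. Once
  \<open>\<phi> N\<close> is close enough to \<open>\<psi>\<close>, no minimizer of
  \<open>\<phi> N\<close> can lie there.\<close>

lemma uniform_limit_opt_set:
  fixes \<phi> :: "nat \<Rightarrow> 'a::real_normed_vector \<Rightarrow> real"
  assumes U: "compact U" "U \<noteq> {}"
    and cont: "\<forall>\<^sub>F N in sequentially. continuous_on U (\<phi> N)"
    and lim: "uniform_limit U \<phi> \<psi> sequentially"
  shows "(\<lambda>N. deviation (opt_set U (\<phi> N)) (opt_set U \<psi>)) \<longlonglongrightarrow> 0"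
proof (rule tendsto_0_ennrealI)
  fix e :: real assume e: "0 < e"
  have cont_\<psi>: "continuous_on U \<psi>" using uniform_limit_theorem[OF cont lim] by simp
  then obtain v where v: "v \<in> opt_set U \<psi>" using opt_set_nonempty[OF U] by blast
  then have "v \<in> U" by (simp add: opt_set_def)
  define C where "C = U - (\<Union>y\<in>opt_set U \<psi>. ball y e)"
  have C: "compact C" "continuous_on C \<psi>" "C \<subseteq> U"
    using U(1) cont_\<psi> by (auto simp: C_def intro!: compact_diff continuous_on_subset[OF cont_\<psi>])
  obtain \<gamma> where \<gamma>: "0 < \<gamma>" "\<And>u. u \<in> C \<Longrightarrow> \<psi> v + \<gamma> \<le> \<psi> u"
  proof (cases "C = {}")
    case False
    then obtain c where c: "c \<in> C" "\<And>u. u \<in> C \<Longrightarrow> \<psi> c \<le> \<psi> u"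
      using continuous_attains_inf[OF C(1) _ C(2)] by auto
    have "c \<notin> opt_set U \<psi>" using c(1) e by (auto simp: C_def)
    moreover have "c \<in> U" using c(1) C(3) by blast
    ultimately have "\<psi> v < \<psi> c" using v by (force simp: opt_set_def)
    then show ?thesis using c(2) by (intro that[of "\<psi> c - \<psi> v"]) auto
  qed (use that[of 1] in auto)
  \<comment> \<open>The approximation error enters twice, at \<open>u\<close> and at
    \<open>v\<close>, and together must stay below \<open>\<gamma>\<close>.\<close>
  have "0 < \<gamma> / 2" using \<gamma>(1) by simp
  from uniform_limitD[OF lim this]
  show "\<forall>\<^sub>F N in sequentially. deviation (opt_set U (\<phi> N)) (opt_set U \<psi>) \<le> ennreal e"
  proof eventually_elim
    case (elim N)
    show ?case
      unfolding deviation_def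
    proof (rule SUP_least)
      fix u assume u: "u \<in> opt_set U (\<phi> N)"
      then have uv: "u \<in> U" "\<phi> N u \<le> \<phi> N v" using \<open>v \<in> U\<close> by (auto simp: opt_set_def)
      have "u \<notin> C"
      proof
        assume "u \<in> C"
        from \<gamma>(2)[OF this] elim[rule_format, of u] elim[rule_format, of v] uv \<open>v \<in> U\<close> show False
          unfolding dist_real_def by (auto simp: abs_real_def split: if_splits)
      qed
      then obtain y where "y \<in> opt_set U \<psi>" "dist y u < e" using uv(1) by (auto simp: C_def)
      then show "(INF y\<in>opt_set U \<psi>. ennreal (norm (u - y))) \<le> ennreal e"
        by (intro INF_lower2[of y]) (auto simp: dist_norm norm_minus_commute intro!: ennreal_leI)
    qed
  qed
qed

text \<open>First countability reduces continuity to sequences, for which dominated convergence is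
  available.\<close>

lemma continuous_on_integral_dominated:
  fixes f :: "'a::{first_countable_topology,t2_space} \<Rightarrow> 'b \<Rightarrow> real"
  assumes "\<And>u. u \<in> U \<Longrightarrow> f u \<in> borel_measurable M"
    and "\<And>x. x \<in> space M \<Longrightarrow> continuous_on U (\<lambda>u. f u x)"
    and "integrable M w" "\<And>u x. u \<in> U \<Longrightarrow> x \<in> space M \<Longrightarrow> \<bar>f u x\<bar> \<le> w x"
  shows "continuous_on U (\<lambda>u. LINT x|M. f u x)"
proof (rule continuous_on_sequentiallyI)
  fix u a assume u: "\<forall>n. u n \<in> U" "a \<in> U" "u \<longlonglongrightarrow> a"
  show "(\<lambda>n. LINT x|M. f (u n) x) \<longlonglongrightarrow> (LINT x|M. f a x)"
  proof (rule integral_dominated_convergence[where w = w])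
    show "AE x in M. (\<lambda>n. f (u n) x) \<longlonglongrightarrow> f a x"
    proof (rule AE_I2)
      fix x assume "x \<in> space M"
      from assms(2)[OF this] u show "(\<lambda>n. f (u n) x) \<longlonglongrightarrow> f a x"
        by (auto intro: continuous_on_tendsto_compose)
    qed
  qed (use assms u in auto)
qed

section \<open>Smoothing\<close>

lemma uniform_modulus_nonneg:
  fixes f :: "'u \<Rightarrow> 'a::real_normed_vector \<Rightarrow> real" and z :: 'a
  assumes "uniform_modulus U f w" "U \<noteq> {}"
  shows "0 \<le> w (norm z)"
  using assms unfolding uniform_modulus_def by (meson abs_ge_zero all_not_in_conv order_trans)

lemma uniform_modulus_tendsto:
  fixes f :: "'u \<Rightarrow> 'a::real_normed_vector \<Rightarrow> real"
  assumes w: "uniform_modulus U f w" "U \<noteq> {}" and lim: "(z \<longlongrightarrow> (0::'a)) G"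
  shows "((\<lambda>k. w (norm (z k))) \<longlongrightarrow> 0) G"
proof (rule tendstoI)
  fix e :: real assume "0 < e"
  moreover have "(w \<longlongrightarrow> 0) (at_right 0)" using w(1) by (simp add: uniform_modulus_def)
  ultimately have "\<forall>\<^sub>F t in at_right 0. w t < e" by (rule order_tendstoD(2)[rotated])
  then obtain b where b: "0 < b" "\<And>t. 0 < t \<Longrightarrow> t < b \<Longrightarrow> w t < e"
    unfolding eventually_at_right_field by blast
  have "\<forall>\<^sub>F k in G. dist (z k) 0 < b" using tendstoD[OF lim b(1)] .
  then show "\<forall>\<^sub>F k in G. dist (w (norm (z k))) 0 < e"
  proof eventually_elim
    case (elim k)
    \<comment> \<open>The right-hand limit says nothing about \<open>w 0\<close>. The midpoint lies
      strictly between 0 and \<open>b\<close> even if \<open>z k = 0\<close>, and monotonicity does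
      the rest.\<close>
    have "w (norm (z k)) \<le> w ((norm (z k) + b) / 2)"
      using w(1) elim b(1) unfolding uniform_modulus_def
      by (auto intro!: mono_onD[of "{0..}" w])
    also have "\<dots> < e" using elim b(1) by (intro b(2)) (auto intro: add_nonneg_pos)
    finally show ?case using uniform_modulus_nonneg[OF w, of "z k"] by simp
  qed
qed

text \<open>Monotonicity is given only on the nonnegative reals. Precomposing with
  \<open>max 0\<close> makes it global without changing values at norms.\<close>

lemma uniform_modulus_measurable:
  assumes "uniform_modulus U f w"
  shows "(\<lambda>z::'a::real_normed_vector. w (norm z)) \<in> borel_measurable borel"
proof -
  have "mono (\<lambda>r. w (max 0 r))"
    using assms by (auto simp: uniform_modulus_def mono_on_def intro!: monoI)
  then have [measurable]: "(\<lambda>r. w (max 0 r)) \<in> borel_measurable borel"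
    by (rule borel_measurable_mono)
  have "(\<lambda>z::'a. w (max 0 (norm z))) \<in> borel_measurable borel" by measurable
  then show ?thesis by (simp add: max_def)
qed

text \<open>The increment is split at \<open>(u', x)\<close>: the move in \<open>x\<close> is
  controlled by the modulus uniformly in \<open>u'\<close>, and the move in \<open>u\<close> happens
  at a fixed \<open>x\<close>.\<close>

lemma uniform_modulus_continuous:
  fixes F :: "'u::topological_space \<Rightarrow> 'a::real_normed_vector \<Rightarrow> real"
  assumes w: "uniform_modulus U F w" and cont: "\<And>x. continuous_on U (\<lambda>u. F u x)"
  shows "continuous_on (U \<times> UNIV) (\<lambda>(u, x). F u x)"
  unfolding continuous_on_def
proof
  fix p :: "'u \<times> 'a" assume "p \<in> U \<times> UNIV"
  then obtain u x where p: "p = (u, x)" and u: "u \<in> U" by auto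
  let ?G = "at (u, x) within U \<times> UNIV"
  have fst: "(fst \<longlongrightarrow> u) ?G" and snd: "(snd \<longlongrightarrow> x) ?G"
    by (auto intro!: tendsto_eq_intros)
  have in_U: "\<forall>\<^sub>F p in ?G. fst p \<in> U"
    by (auto simp: eventually_at_topological)
  have "((\<lambda>p. F (fst p) x) \<longlongrightarrow> F u x) ?G"
    using continuous_on_tendsto_compose[OF cont fst u in_U] .
  moreover have "((\<lambda>p. F (fst p) (snd p) - F (fst p) x) \<longlongrightarrow> 0) ?G"
  proof (rule Lim_null_comparison)
    show "\<forall>\<^sub>F p in ?G. norm (F (fst p) (snd p) - F (fst p) x) \<le> w (norm (snd p - x))"
      using in_U
    proof eventually_elim
      case (elim p)
      then have "\<bar>F (fst p) (x + (snd p - x)) - F (fst p) x\<bar> \<le> w (norm (snd p - x))"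
        using w unfolding uniform_modulus_def by blast
      then show ?case by simp
    qed
    show "((\<lambda>p. w (norm (snd p - x))) \<longlongrightarrow> 0) ?G"
      using u snd by (intro uniform_modulus_tendsto[OF w]) (auto simp: LIM_zero)
  qed
  ultimately have "((\<lambda>p. F (fst p) (snd p) - F (fst p) x + F (fst p) x) \<longlongrightarrow> 0 + F u x) ?G"
    by (intro tendsto_add)
  then show "((\<lambda>(u, x). F u x) \<longlongrightarrow> (case p of (u, x) \<Rightarrow> F u x)) (at p within U \<times> UNIV)"
    by (simp add: p case_prod_beta')
qed

section \<open>Smoothing by signed measures\<close>

lemma tv_nn_integral_finiteD:
  assumes \<nu>: "signed_measure \<nu>" and W: "W \<in> borel_measurable borel" "\<And>z. 0 \<le> W z"
    and fin: "tv_nn_integral \<nu> (\<lambda>z. ennreal (W z)) < \<infinity>"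
  shows "integrable (fst \<nu>) W" "integrable (snd \<nu>) W"
    "enn2real (tv_nn_integral \<nu> (\<lambda>z. ennreal (W z))) = (LINT z|fst \<nu>. W z) + (LINT z|snd \<nu>. W z)"
proof -
  have sets [measurable_cong]: "sets (fst \<nu>) = sets borel" "sets (snd \<nu>) = sets borel"
    using \<nu> by (auto simp: signed_measure_def)
  show int: "integrable (fst \<nu>) W" "integrable (snd \<nu>) W"
    using fin W by (auto intro!: integrableI_nonneg simp: tv_nn_integral_def sets cong: measurable_cong_sets)
  show "enn2real (tv_nn_integral \<nu> (\<lambda>z. ennreal (W z))) = (LINT z|fst \<nu>. W z) + (LINT z|snd \<nu>. W z)"
    using int W(2) by (simp add: tv_nn_integral_def nn_integral_eq_integral ennreal_plus[symmetric] del: ennreal_plus)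
qed

text \<open>Total mass 1 turns \<open>c\<close> into the integral of the constant \<open>c\<close>,
  so the difference is the integral of \<open>f - c\<close>, which \<open>W\<close> dominates on
  each Jordan part.\<close>

lemma sintegral_diff_le:
  assumes \<nu>: "signed_measure \<nu>" "smeas \<nu> UNIV = 1"
    and W: "W \<in> borel_measurable borel" "\<And>z. \<bar>f z - c\<bar> \<le> W z"
    and f: "f \<in> borel_measurable borel"
    and fin: "tv_nn_integral \<nu> (\<lambda>z. ennreal (W z)) < \<infinity>"
  shows "\<bar>sintegral \<nu> f - c\<bar> \<le> enn2real (tv_nn_integral \<nu> (\<lambda>z. ennreal (W z)))"
proof -
  interpret P: finite_measure "fst \<nu>" using \<nu> by (simp add: signed_measure_def)
  interpret Q: finite_measure "snd \<nu>" using \<nu> by (simp add: signed_measure_def)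
  have sets: "sets (fst \<nu>) = sets borel" "sets (snd \<nu>) = sets borel"
    using \<nu> by (auto simp: signed_measure_def)
  have space: "space (fst \<nu>) = UNIV" "space (snd \<nu>) = UNIV"
    using sets[THEN sets_eq_imp_space_eq] by auto
  have W0: "0 \<le> W z" for z using W(2)[of z] by linarith
  note W_int = tv_nn_integral_finiteD[OF \<nu>(1) W(1) W0 fin]
  have d: "integrable (fst \<nu>) (\<lambda>z. f z - c)" "integrable (snd \<nu>) (\<lambda>z. f z - c)"
    using f W(2) W0
    by (auto intro!: Bochner_Integration.integrable_bound[OF W_int(1)] Bochner_Integration.integrable_bound[OF W_int(2)] simp: sets cong: measurable_cong_sets)
  \<comment> \<open>Both parts are finite measures, so adding the constant back preserves
    integrability.\<close>
  have "integrable (fst \<nu>) (\<lambda>z. f z - c + c)" "integrable (snd \<nu>) (\<lambda>z. f z - c + c)"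
    by (intro Bochner_Integration.integrable_add d; simp)+
  then have i: "integrable (fst \<nu>) f" "integrable (snd \<nu>) f" by simp_all
  have "sintegral \<nu> f - c = sintegral \<nu> f - c * smeas \<nu> UNIV" using \<nu>(2) by simp
  also have "\<dots> = (LINT z|fst \<nu>. f z - c) - (LINT z|snd \<nu>. f z - c)"
    using i by (simp add: sintegral_def smeas_def space algebra_simps)
  finally have "\<bar>sintegral \<nu> f - c\<bar> \<le> \<bar>LINT z|fst \<nu>. f z - c\<bar> + \<bar>LINT z|snd \<nu>. f z - c\<bar>" by linarith
  also have "\<bar>LINT z|fst \<nu>. f z - c\<bar> \<le> (LINT z|fst \<nu>. W z)"
    using W(2) d W_int by (intro order_trans[OF integral_abs_bound] integral_mono) auto
  also have "\<bar>LINT z|snd \<nu>. f z - c\<bar> \<le> (LINT z|snd \<nu>. W z)"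
    using W(2) d W_int by (intro order_trans[OF integral_abs_bound] integral_mono) auto
  finally show ?thesis using W_int(3) by simp
qed

text \<open>A deterministic statement about one outcome: the almost sure facts enter as hypotheses
  on \<open>\<omega>\<close>. The smoothing error is at most the total variation integral of the
  modulus, for all \<open>u\<close> at once.\<close>

lemma conv_objective_consistent:
  fixes F :: "'u::real_normed_vector \<Rightarrow> 'a::real_normed_vector \<Rightarrow> real"
  assumes U: "compact U" "U \<noteq> {}"
    and \<mu>: "\<And>N. N \<ge> 1 \<Longrightarrow> signed_measure (\<mu> N \<omega>) \<and> smeas (\<mu> N \<omega>) UNIV = 1"
    and w: "uniform_modulus U F w"
    and tv: "(\<lambda>N. tv_nn_integral (\<mu> N \<omega>) (\<lambda>z. ennreal (w (norm z)))) \<longlonglongrightarrow> 0"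
    and cont: "\<And>x. continuous_on U (\<lambda>u. F u x)" and env: "\<And>u x. u \<in> U \<Longrightarrow> \<bar>F u x\<bar> \<le> g x"
    and lim: "uniform_limit U (\<lambda>N u. (\<Sum>i=1..N. F u (X i \<omega>)) / real N) obj sequentially"
  shows "(\<lambda>N. opt_value U (conv_objective F X \<mu> N \<omega>)) \<longlonglongrightarrow> opt_value U obj"
    and "(\<lambda>N. deviation (opt_set U (conv_objective F X \<mu> N \<omega>)) (opt_set U obj)) \<longlonglongrightarrow> 0"
proof -
  let ?tv = "\<lambda>N. tv_nn_integral (\<mu> N \<omega>) (\<lambda>z. ennreal (w (norm z)))"
  note W = uniform_modulus_measurable[OF w]
  have mod: "\<bar>F u (x + z) - F u x\<bar> \<le> w (norm z)" if "u \<in> U" for u x z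
    using w that by (auto simp: uniform_modulus_def)
  have F_cont: "continuous_on UNIV (\<lambda>z. F u (x + z))" if "u \<in> U" for u x
  proof -
    have "continuous_on UNIV (\<lambda>z. case (u, x + z) of (u, x) \<Rightarrow> F u x)"
      by (rule continuous_on_compose2[OF uniform_modulus_continuous[OF w cont]])
        (use that in \<open>auto intro!: continuous_intros\<close>)
    then show ?thesis by simp
  qed
  \<comment> \<open>Nothing is known about index 0, and finitely many of the extended integrals may
    be infinite.\<close>
  have fin: "\<forall>\<^sub>F N in sequentially. N \<ge> 1 \<and> ?tv N < \<infinity>"
    using order_tendstoD(2)[OF tv, of \<infinity>] eventually_ge_at_top[of 1] by (auto intro: eventually_conj)
  have "\<forall>\<^sub>F N in sequentially. continuous_on U (conv_objective F X \<mu> N \<omega>)"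
    using fin
  proof eventually_elim
    case (elim N)
    then have \<nu>: "signed_measure (\<mu> N \<omega>)" using \<mu> by auto
    then have sets: "sets (fst (\<mu> N \<omega>)) = sets borel" "sets (snd (\<mu> N \<omega>)) = sets borel"
      and fm: "finite_measure (fst (\<mu> N \<omega>))" "finite_measure (snd (\<mu> N \<omega>))"
      by (auto simp: signed_measure_def)
    have c: "continuous_on U (\<lambda>u. LINT z|\<nu>. F u (x + z))"
      if [simp]: "sets \<nu> = sets borel" and "finite_measure \<nu>" and int: "integrable \<nu> (\<lambda>z. w (norm z))" for \<nu> x
    \<comment> \<open>The envelope is used only at the sample point \<open>x\<close>, where it is a
      constant; the modulus accounts for the displacement \<open>z\<close>.\<close>
    proof (rule continuous_on_integral_dominated[where w = "\<lambda>z. g x + w (norm z)"])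
      interpret finite_measure \<nu> by fact
      show "integrable \<nu> (\<lambda>z. g x + w (norm z))" using int by simp
      show "(\<lambda>z. F u (x + z)) \<in> borel_measurable \<nu>" if "u \<in> U" for u
        using borel_measurable_continuous_onI[OF F_cont[OF that]] by (simp cong: measurable_cong_sets)
      show "\<bar>F u (x + z)\<bar> \<le> g x + w (norm z)" if "u \<in> U" for u z
        using mod[OF that, of x z] env[OF that, of x] by linarith
    qed (rule cont)
    note W_int = tv_nn_integral_finiteD[OF \<nu> W uniform_modulus_nonneg[OF w U(2)] conjunct2[OF elim]]
    show ?case
      unfolding conv_objective_def sintegral_def using c[OF sets(1) fm(1) W_int(1)] c[OF sets(2) fm(2) W_int(2)]
        elim
      by (intro continuous_intros) auto
  qed
  moreover have "uniform_limit U (\<lambda>N. conv_objective F X \<mu> N \<omega>) obj sequentially"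
  proof (rule uniform_limitI)
    fix e :: real assume "0 < e"
    then have e: "0 < e / 2" by simp
    have "(\<lambda>N. enn2real (?tv N)) \<longlonglongrightarrow> 0" using tendsto_enn2real[of ?tv 0] tv by simp
    then have "\<forall>\<^sub>F N in sequentially. enn2real (?tv N) < e / 2" using e by (rule order_tendstoD(2))
    with fin uniform_limitD[OF lim e]
    show "\<forall>\<^sub>F N in sequentially. \<forall>u\<in>U. dist (conv_objective F X \<mu> N \<omega> u) (obj u) < e"
    proof eventually_elim
      case (elim N)
      show ?case
      proof
        fix u assume u: "u \<in> U"
        have "\<bar>conv_objective F X \<mu> N \<omega> u - (\<Sum>i=1..N. F u (X i \<omega>)) / real N\<bar>
            = \<bar>\<Sum>i=1..N. sintegral (\<mu> N \<omega>) (\<lambda>z. F u (X i \<omega> + z)) - F u (X i \<omega>)\<bar> / real N"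
          by (simp add: conv_objective_def sum_subtractf diff_divide_distrib[symmetric])
        also have "\<dots> \<le> (\<Sum>i=1..N. enn2real (?tv N)) / real N"
          using \<mu>[of N] elim(1) u mod
          by (intro divide_right_mono order_trans[OF sum_abs] sum_mono sintegral_diff_le W
              borel_measurable_continuous_onI F_cont) auto
        also have "\<dots> = enn2real (?tv N)" using elim(1) by simp
        finally show "dist (conv_objective F X \<mu> N \<omega> u) (obj u) < e"
          using elim(2)[rule_format, OF u] elim(3) unfolding dist_real_def by linarith
      qed
    qed
  qed
  ultimately show "(\<lambda>N. opt_value U (conv_objective F X \<mu> N \<omega>)) \<longlonglongrightarrow> opt_value U obj"
      "(\<lambda>N. deviation (opt_set U (conv_objective F X \<mu> N \<omega>)) (opt_set U obj)) \<longlonglongrightarrow> 0"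
    by (rule uniform_limit_opt_value[OF U], rule uniform_limit_opt_set[OF U])
qed

text \<open>The law of \<open>c Z\<close> for a random vector \<open>Z\<close> with density \<open>K\<close>: smoothing by it turns the kernel
  estimator into a convolution estimator.\<close>

definition kernel_measure :: "('a::euclidean_space \<Rightarrow> real) \<Rightarrow> real \<Rightarrow> 'a smeasure" where
  "kernel_measure K c = (distr (density lborel K) borel (\<lambda>z. c *\<^sub>R z), null_measure borel)"

lemma kernel_measure_signed:
  assumes K [measurable]: "K \<in> borel_measurable borel" and "\<And>y. 0 \<le> K y" "has_bochner_integral lborel K 1"
  shows "signed_measure (kernel_measure K c)" "smeas (kernel_measure K c) UNIV = 1"
proof -
  have "(\<integral>\<^sup>+y. ennreal (K y) \<partial>lborel) = 1"
    using assms by (subst nn_integral_eq_integral) (auto simp: has_bochner_integral_iff)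
  then have "emeasure (density lborel K) UNIV = 1" by (simp add: emeasure_density)
  then have "prob_space (density lborel K)" by (intro prob_spaceI) simp
  then have P: "prob_space (distr (density lborel K) borel (\<lambda>z. c *\<^sub>R z))"
    by (rule prob_space.prob_space_distr) simp
  then show "smeas (kernel_measure K c) UNIV = 1"
    using prob_space.prob_space[OF P] by (simp add: smeas_def kernel_measure_def)
  show "signed_measure (kernel_measure K c)"
    using P by (auto simp: signed_measure_def kernel_measure_def prob_space_def intro!: finite_measureI bexI[of _ UNIV])
qed

text \<open>The substitution \<open>x = a + h N *\<^sub>R z\<close> has Jacobian
  \<open>h N ^ CARD('m)\<close>, which cancels the normalization of the kernel.\<close>

lemma conv_objective_kernel_measure:
  fixes X :: "nat \<Rightarrow> 'w \<Rightarrow> real ^ 'm"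
  assumes K [measurable]: "K \<in> borel_measurable borel" and K0: "\<And>y. 0 \<le> K y"
    and F [measurable]: "F u \<in> borel_measurable borel" and h: "0 < h N"
  shows "conv_objective F X (\<lambda>N \<omega>. kernel_measure K (h N)) N \<omega> u = kernel_objective F X K h N \<omega> u"
proof -
  have "(LINT x|lborel. F u x * K ((x - a) /\<^sub>R h N) * (1 / h N ^ CARD('m)))
      = sintegral (kernel_measure K (h N)) (\<lambda>z. F u (a + z))" for a :: "real ^ 'm"
  proof -
    have "(LINT x|lborel. F u x * K ((x - a) /\<^sub>R h N) * (1 / h N ^ CARD('m)))
        = (LINT z|lborel. \<bar>h N\<bar> ^ CARD('m) *
            (F u (a + h N *\<^sub>R z) * K ((a + h N *\<^sub>R z - a) /\<^sub>R h N) * (1 / h N ^ CARD('m))))"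
    proof -
      have "(lborel :: (real ^ 'm) measure) =
          density (distr lborel borel (\<lambda>z. a + h N *\<^sub>R z)) (\<lambda>_. ennreal (\<bar>h N\<bar> ^ CARD('m)))"
        using lborel_affine[of "h N" a] h by (simp add: ennreal_power)
      then show ?thesis
        by (subst (1) \<open>lborel = _\<close>, subst integral_density) (simp_all add: integral_distr)
    qed
    also have "\<dots> = (LINT z|lborel. K z * F u (a + h N *\<^sub>R z))"
      using h by (intro Bochner_Integration.integral_cong) (auto simp: field_simps)
    also have "\<dots> = sintegral (kernel_measure K (h N)) (\<lambda>z. F u (a + z))"
      using K0 by (simp add: sintegral_def kernel_measure_def integral_distr integral_density)
    finally show ?thesis .
  qed
  then show ?thesis by (simp add: conv_objective_def kernel_objective_def)
qed

text \<open>Contracting \<open>z\<close> by a factor of at most 1 does not increase the modulus.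
  Hence \<open>w (norm z) * K z\<close> dominates, while the integrand tends to 0 pointwise.\<close>

lemma tv_nn_integral_kernel_measure:
  fixes F :: "'u \<Rightarrow> 'a::euclidean_space \<Rightarrow> real" and K :: "'a \<Rightarrow> real"
  assumes K [measurable]: "K \<in> borel_measurable borel" and K0: "\<And>y. 0 \<le> K y"
    and w: "uniform_modulus U F w" "U \<noteq> {}"
    and int: "integrable lborel (\<lambda>z. w (norm z) * K z)" and h: "h \<longlonglongrightarrow> 0"
  shows "(\<lambda>N. tv_nn_integral (kernel_measure K (h N)) (\<lambda>z. ennreal (w (norm z)))) \<longlonglongrightarrow> 0"
proof -
  note W [measurable] = uniform_modulus_measurable[OF w(1), where 'a = 'a]
  \<comment> \<open>The cap makes the majorant valid for every \<open>N\<close>, and it is inactive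
    once \<open>\<bar>h N\<bar> < 1\<close>.\<close>
  define h' where "h' N = min 1 \<bar>h N\<bar>" for N
  have scaled: "w (norm (h' N *\<^sub>R z)) \<le> w (norm z)" for N and z :: 'a
  proof -
    have "norm (h' N *\<^sub>R z) \<le> norm z"
      unfolding norm_scaleR by (intro mult_left_le_one_le) (auto simp: h'_def)
    then show ?thesis using w(1) unfolding uniform_modulus_def by (auto intro!: mono_onD[of "{0..}" w])
  qed
  have h'0: "h' \<longlonglongrightarrow> 0" using tendsto_min[OF tendsto_const[of 1] tendsto_rabs[OF h]] by (simp add: h'_def[abs_def])
  have bound: "norm (w (norm (h' N *\<^sub>R z)) * K z) \<le> w (norm z) * K z" for N and z :: 'a
    using scaled[of N z] uniform_modulus_nonneg[OF w, of "h' N *\<^sub>R z"] K0[of z]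
    by (simp only: real_norm_def abs_mult) (auto intro!: mult_right_mono)
  have "(\<lambda>N. LINT z|lborel. w (norm (h' N *\<^sub>R z)) * K z) \<longlonglongrightarrow> (LINT z::'a|lborel. 0)"
  proof (rule integral_dominated_convergence[where w = "\<lambda>z. w (norm z) * K z"])
    show "(\<lambda>z. w (norm (h' N *\<^sub>R z)) * K z) \<in> borel_measurable lborel" for N
      using measurable_compose[OF _ W, of "\<lambda>z. h' N *\<^sub>R z" borel] by simp
    show "AE z in lborel. (\<lambda>N. w (norm (h' N *\<^sub>R z)) * K z) \<longlonglongrightarrow> 0"
    proof (rule AE_I2)
      fix z :: 'a
      have "(\<lambda>N. h' N *\<^sub>R z) \<longlonglongrightarrow> 0" using h'0 by (auto intro!: tendsto_eq_intros)
      from tendsto_mult_left_zero[OF uniform_modulus_tendsto[OF w this]]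
      show "(\<lambda>N. w (norm (h' N *\<^sub>R z)) * K z) \<longlonglongrightarrow> 0" .
    qed
  qed (use bound int in auto)
  then have lim: "(\<lambda>N. ennreal (LINT z|lborel. w (norm (h' N *\<^sub>R z)) * K z)) \<longlonglongrightarrow> 0"
    using tendsto_ennrealI[of _ 0] by simp
  have "\<forall>\<^sub>F N in sequentially. \<bar>h N\<bar> < 1" using order_tendstoD(2)[OF tendsto_rabs[OF h], of 1] by simp
  then have "\<forall>\<^sub>F N in sequentially. ennreal (LINT z|lborel. w (norm (h' N *\<^sub>R z)) * K z)
      = tv_nn_integral (kernel_measure K (h N)) (\<lambda>z. ennreal (w (norm z)))"
  proof eventually_elim
    case (elim N)
    then have eq: "norm (h' N *\<^sub>R z) = norm (h N *\<^sub>R z)" for z :: 'a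
      by (simp add: h'_def)
    have m: "(\<lambda>z::'a. w (norm (h N *\<^sub>R z))) \<in> borel_measurable borel"
      using measurable_compose[OF _ W, of "\<lambda>z. h N *\<^sub>R z" borel] by simp
    have i: "integrable lborel (\<lambda>z. w (norm (h N *\<^sub>R z)) * K z)"
      using bound[of N] m unfolding eq
      by (intro Bochner_Integration.integrable_bound[OF int]) (auto intro: order_trans[OF _ abs_ge_self])
    have "tv_nn_integral (kernel_measure K (h N)) (\<lambda>z. ennreal (w (norm z)))
        = (\<integral>\<^sup>+z. ennreal (K z) * ennreal (w (norm (h N *\<^sub>R z))) \<partial>lborel)"
      using m by (simp add: tv_nn_integral_def kernel_measure_def nn_integral_distr nn_integral_density del: norm_scaleR)
    also have "\<dots> = (\<integral>\<^sup>+z. ennreal (w (norm (h N *\<^sub>R z)) * K z) \<partial>lborel)"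
      by (intro nn_integral_cong) (metis ennreal_mult' K0 mult.commute)
    also have "\<dots> = ennreal (LINT z|lborel. w (norm (h N *\<^sub>R z)) * K z)"
      using i K0 uniform_modulus_nonneg[OF w] by (intro nn_integral_eq_integral) (auto simp del: norm_scaleR)
    finally show ?case by (simp only: eq)
  qed
  from tendsto_cong[OF this] lim show ?thesis by simp
qed

theorem theorem4:
  fixes M :: "'w measure"
    and U :: "(real ^ 'n) set"
    and F :: "real ^ 'n \<Rightarrow> real ^ 'm \<Rightarrow> real"
    and X0 :: "'w \<Rightarrow> real ^ 'm"
    and X :: "nat \<Rightarrow> 'w \<Rightarrow> real ^ 'm"
    and g :: "real ^ 'm \<Rightarrow> real"
  defines "obj \<equiv> (\<lambda>u. LINT \<omega>|M. F u (X0 \<omega>))"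
  assumes "prob_space M"
    and U: "U \<noteq> {}" "closed U"
    and X0: "integrable M X0"
    and F: "\<And>u. u \<in> U \<Longrightarrow> integrable M (\<lambda>\<omega>. F u (X0 \<omega>))"
    and indep: "prob_space.indep_vars M (\<lambda>_. borel) X {1..}"
    and ident: "\<And>i. i \<ge> 1 \<Longrightarrow> distr M borel (X i) = distr M borel X0"
    and c2: "integrable (distr M borel X0) g" "\<And>u x. u \<in> U \<Longrightarrow> \<bar>F u x\<bar> \<le> g x"
    and c3: "\<And>x. continuous_on UNIV (\<lambda>u. F u x)"
    and c4: "compact U"
  shows
    "(\<forall>\<mu>. proper_approx_conv_identity M X \<mu> \<and>
          (\<exists>w. uniform_modulus U F w \<and> adapted_modulus M \<mu> w) \<longrightarrow>
        (AE \<omega> in M. (\<lambda>N. opt_value U (conv_objective F X \<mu> N \<omega>)) \<longlonglongrightarrow> opt_value U obj) \<and>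
        (AE \<omega> in M. (\<lambda>N. deviation (opt_set U (conv_objective F X \<mu> N \<omega>)) (opt_set U obj)) \<longlonglongrightarrow> 0))
   \<and> (\<forall>K h. symmetric_density K \<and> finite_positive_second_moment K \<and>
          (\<forall>N\<ge>1. 0 < h N) \<and> h \<longlonglongrightarrow> 0 \<and>
          (\<exists>w. uniform_modulus U F w \<and> integrable lborel (\<lambda>z. w (norm z) * K z)) \<longrightarrow>
        (AE \<omega> in M. (\<lambda>N. opt_value U (kernel_objective F X K h N \<omega>)) \<longlonglongrightarrow> opt_value U obj) \<and>
        (AE \<omega> in M. (\<lambda>N. deviation (opt_set U (kernel_objective F X K h N \<omega>)) (opt_set U obj)) \<longlonglongrightarrow> 0))"
proof -
  interpret prob_space M by fact
  have [measurable]: "X0 \<in> borel_measurable M" using X0 by auto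
  have g: "g \<in> borel_measurable borel" "integrable M (\<lambda>\<omega>. g (X0 \<omega>))"
    using c2(1) borel_measurable_integrable[OF c2(1)] by (auto simp: integrable_distr_eq)
  have cont: "continuous_on U (\<lambda>u. F u x)" for x
    using c3 by (rule continuous_on_subset) simp
  have ulln: "AE \<omega> in M. uniform_limit U (\<lambda>N u. (\<Sum>i=1..N. F u (X i \<omega>)) / real N) obj sequentially"
    if "uniform_modulus U F w" for w
    unfolding obj_def
    by (rule uniform_strong_law[OF indep ident _ c4 uniform_modulus_continuous[OF that cont] g c2(2)]) auto
  \<comment> \<open>Phrased for normalized signed measures with an adapted modulus, so that the
    rescaled kernels become an instance.\<close>
  have conv: "(AE \<omega> in M. (\<lambda>N. opt_value U (conv_objective F X \<mu> N \<omega>)) \<longlonglongrightarrow> opt_value U obj) \<and>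
      (AE \<omega> in M. (\<lambda>N. deviation (opt_set U (conv_objective F X \<mu> N \<omega>)) (opt_set U obj)) \<longlonglongrightarrow> 0)"
    if \<mu>: "\<And>N \<omega>. N \<ge> 1 \<Longrightarrow> \<omega> \<in> space M \<Longrightarrow> signed_measure (\<mu> N \<omega>) \<and> smeas (\<mu> N \<omega>) UNIV = 1"
      and w: "uniform_modulus U F w" and adapted: "adapted_modulus M \<mu> w" for \<mu> w
  proof -
    have "AE \<omega> in M. (\<lambda>N. opt_value U (conv_objective F X \<mu> N \<omega>)) \<longlonglongrightarrow> opt_value U obj \<and>
      (\<lambda>N. deviation (opt_set U (conv_objective F X \<mu> N \<omega>)) (opt_set U obj)) \<longlonglongrightarrow> 0"
      using ulln[OF w] adapted[unfolded adapted_modulus_def] AE_space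
    proof eventually_elim
      case (elim \<omega>)
      show ?case
        using conv_objective_consistent[where \<omega> = \<omega> and \<mu> = \<mu> and X = X and g = g, OF c4 U(1) \<mu>[OF _ elim(3)] w elim(2) cont c2(2) elim(1)] by blast
    qed
    then show ?thesis by (simp add: AE_conj_iff)
  qed
  have "(AE \<omega> in M. (\<lambda>N. opt_value U (kernel_objective F X K h N \<omega>)) \<longlonglongrightarrow> opt_value U obj) \<and>
      (AE \<omega> in M. (\<lambda>N. deviation (opt_set U (kernel_objective F X K h N \<omega>)) (opt_set U obj)) \<longlonglongrightarrow> 0)"
    if K: "symmetric_density K" and h: "\<forall>N\<ge>1. 0 < h N" "h \<longlonglongrightarrow> 0"
      and w: "uniform_modulus U F w" "integrable lborel (\<lambda>z. w (norm z) * K z)" for K h w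
  proof -
    let ?\<mu> = "\<lambda>N \<omega>::'w. kernel_measure K (h N)"
    have K: "K \<in> borel_measurable borel" "\<And>y. 0 \<le> K y" "has_bochner_integral lborel K 1"
      using K by (auto simp: symmetric_density_def)
    have F_meas: "F u \<in> borel_measurable borel" if "u \<in> U" for u
    proof (rule borel_measurable_continuous_onI)
      have "continuous_on UNIV (\<lambda>x. case (u, x) of (u, x) \<Rightarrow> F u x)"
        by (rule continuous_on_compose2[OF uniform_modulus_continuous[OF w(1) cont]])
          (use that in \<open>auto intro!: continuous_intros\<close>)
      then show "continuous_on UNIV (F u)" by simp
    qed
    have eq: "conv_objective F X ?\<mu> N \<omega> u = kernel_objective F X K h N \<omega> u" if "N \<ge> 1" "u \<in> U" for N \<omega> u
      using conv_objective_kernel_measure[of K F u h N X \<omega>] K F_meas h that by auto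
    \<comment> \<open>The objectives are identified only on \<open>U\<close> and from
      \<open>N = 1\<close> on, which is enough for optimal values, optimal sets and limits.\<close>
    have "opt_value U (conv_objective F X ?\<mu> N \<omega>) = opt_value U (kernel_objective F X K h N \<omega>)"
      "opt_set U (conv_objective F X ?\<mu> N \<omega>) = opt_set U (kernel_objective F X K h N \<omega>)" if "N \<ge> 1" for N \<omega>
      using eq[OF that] unfolding opt_value_def opt_set_def by (simp_all cong: image_cong conj_cong)
    then have "(\<lambda>N. opt_value U (conv_objective F X ?\<mu> N \<omega>)) \<longlonglongrightarrow> opt_value U obj \<longleftrightarrow>
        (\<lambda>N. opt_value U (kernel_objective F X K h N \<omega>)) \<longlonglongrightarrow> opt_value U obj"
      "(\<lambda>N. deviation (opt_set U (conv_objective F X ?\<mu> N \<omega>)) (opt_set U obj)) \<longlonglongrightarrow> 0 \<longleftrightarrow>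
        (\<lambda>N. deviation (opt_set U (kernel_objective F X K h N \<omega>)) (opt_set U obj)) \<longlonglongrightarrow> 0" for \<omega>
      by (auto intro!: tendsto_cong eventually_sequentiallyI[of 1])
    moreover have "adapted_modulus M ?\<mu> w"
      unfolding adapted_modulus_def
      using tv_nn_integral_kernel_measure[OF K(1,2) w(1) U(1) w(2) h(2)] by simp
    ultimately show ?thesis
      using conv[of ?\<mu> w] kernel_measure_signed[OF K] w(1) by simp
  qed
  with conv show ?thesis
    unfolding proper_approx_conv_identity_def by blast
qed

end
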